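(* Let $d>1$ be a positive integer. Then the sequences of remainders $(D_n^{(o)}\bmod d)_{n\in\mathbb{N}}$ and $(D_n^{(e)}\bmod d)_{n\in\mathbb{N}}$ are periodic with period $2d$.
   Context: $\mathbb{N}=\{0,1,2,\dots\}$. $D_n^{(e)}$ (respectively $D_n^{(o)}$) is the number of even (respectively odd) permutations of an $n$-element set without fixed points. They satisfy $D_0^{(e)}=1$, $D_1^{(e)}=0$, $D_0^{(o)}=0$, $D_1^{(o)}=0$, and $D_n^{(e)}=(n-1)(D_{n-2}^{(o)}+D_{n-1}^{(o)})$, $D_n^{(o)}=(n-1)(D_{n-2}^{(e)}+D_{n-1}^{(e)})$ for $n\ge2$. A period is a positive integer $T$ such that the $n$-th and $(n+T)$-th terms agree for all $n$; it need not be the least one. *)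

theory Defs
  imports "HOL-Combinatorics.Permutations"
begin

definition derangements :: "'a set \<Rightarrow> ('a \<Rightarrow> 'a) set" where
  "derangements A = {p. p permutes A \<and> (\<forall>x\<in>A. p x \<noteq> x)}"

text \<open>The standard \<open>n\<close>-element set \<open>{..<n}\<close> is used. For \<open>n = 0\<close> the identity is
  the only derangement, and it is even.\<close>

definition even_derangement_number :: "nat \<Rightarrow> nat" where
  "even_derangement_number n = card {p \<in> derangements {..<n}. evenperm p}"

definition odd_derangement_number :: "nat \<Rightarrow> nat" where
  "odd_derangement_number n = card {p \<in> derangements {..<n}. \<not> evenperm p}"

text \<open>A period need not be the least one.\<close>

definition is_period :: "(nat \<Rightarrow> 'a) \<Rightarrow> nat \<Rightarrow> bool" where
  "is_period f T \<longleftrightarrow> T > 0 \<and> (\<forall>n. f (n + T) = f n)"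

end

theory Submission
  imports Defs HOL.Binomial
begin

text \<open>Every permutation is a derangement of its set of moved points, so Moebius inversion over
  subsets expresses any weighted sum over derangements through sums over all permutations. The
  weights \<open>1\<close> and \<open>sign\<close> give the number \<open>D\<^sub>n\<close> of derangements, with
  \<open>D\<^sub>n\<^sub>+\<^sub>1 = (n+1) D\<^sub>n + (-1)\<^sup>n\<^sup>+\<^sup>1\<close>, and the difference
  \<open>E\<^sub>n = (-1)\<^sup>n (1 - n)\<close> of the even and odd counts. Both are periodic
  modulo \<open>2d\<close> with period \<open>2d\<close>; the even and odd counts are \<open>(D\<^sub>n \<plusminus> E\<^sub>n) / 2\<close>, so halving leaves
  periodicity modulo \<open>d\<close>.\<close>

text \<open>A derangement determines the set it deranges, namely its moved points. Hence
  derangements of different sets are different, and the union over subsets below is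
  disjoint.\<close>

lemma mem_derangements_iff:
  "p \<in> derangements T \<longleftrightarrow> p permutes T \<and> T = {x. p x \<noteq> x}"
  by (auto simp: derangements_def permutes_def)

lemma finite_derangements: "finite A \<Longrightarrow> finite (derangements A)"
  by (rule finite_subset[OF _ finite_permutations]) (auto simp: derangements_def)

lemma permutes_eq_Union_derangements:
  "{p. p permutes S} = (\<Union>T\<in>Pow S. derangements T)"
proof (intro equalityI subsetI)
  fix p assume "p \<in> {p. p permutes S}"
  then have p: "p permutes S" by simp
  have "p permutes {x. p x \<noteq> x}"
    by (rule permutes_superset[OF p]) auto
  moreover have "{x. p x \<noteq> x} \<subseteq> S"
    using p by (auto simp: permutes_def)
  ultimately show "p \<in> (\<Union>T\<in>Pow S. derangements T)"
    by (auto simp: mem_derangements_iff)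
qed (auto simp: derangements_def intro: permutes_subset)

lemma sum_derangements:
  fixes w :: "('a \<Rightarrow> 'a) \<Rightarrow> int"
  assumes "finite A"
  shows "(\<Sum>p\<in>derangements A. w p) =
    (\<Sum>T\<in>Pow A. (-1) ^ (card A - card T) * (\<Sum>p | p permutes T. w p))"
proof (rule inclusion_exclusion_mobius[OF _ assms])
  \<comment> \<open>What the inversion needs is the converse relation: sorting the permutations of
    \<open>S\<close> by their moved points.\<close>
  fix S :: "'a set" assume "finite S"
  then have "finite (derangements T)" if "T \<in> Pow S" for T
    using that finite_derangements finite_subset by blast
  moreover have "derangements T \<inter> derangements U = {}" if "T \<noteq> U" for T U :: "'a set"
    using that by (auto simp: mem_derangements_iff)
  ultimately show "(\<Sum>p | p permutes S. w p) = (\<Sum>T\<in>Pow S. \<Sum>p\<in>derangements T. w p)"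
    unfolding permutes_eq_Union_derangements using \<open>finite S\<close>
    by (intro sum.UNION_disjoint) auto
qed

lemma sum_Pow_card:
  fixes h :: "nat \<Rightarrow> 'b::comm_semiring_1"
  assumes "finite A"
  shows "(\<Sum>T\<in>Pow A. h (card T)) = (\<Sum>k\<le>card A. of_nat (card A choose k) * h k)"
proof -
  have "(\<Sum>T\<in>Pow A. h (card T)) = (\<Sum>k\<le>card A. \<Sum>T | T \<in> Pow A \<and> card T = k. h (card T))"
    by (rule sum.group[symmetric]) (use assms in \<open>auto intro: card_mono\<close>)
  also have "\<dots> = (\<Sum>k\<le>card A. of_nat (card A choose k) * h k)"
    using n_subsets[OF assms] by (intro sum.cong) auto
  finally show ?thesis .
qed

text \<open>Used twice: weight \<open>1\<close> with \<open>G\<close> the factorial, and weight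
  \<open>sign\<close> with \<open>G\<close> the indicator of \<open>k \<le> 1\<close>.\<close>

lemma sum_derangements_by_card:
  fixes w :: "('a \<Rightarrow> 'a) \<Rightarrow> int"
  assumes "finite A"
    and "\<And>T. finite T \<Longrightarrow> (\<Sum>p | p permutes T. w p) = G (card T)"
  shows "(\<Sum>p\<in>derangements A. w p) =
    (\<Sum>k\<le>card A. int (card A choose k) * ((-1) ^ (card A - k) * G k))"
proof -
  have "(\<Sum>p\<in>derangements A. w p) = (\<Sum>T\<in>Pow A. (-1) ^ (card A - card T) * G (card T))"
    unfolding sum_derangements[OF assms(1)]
    by (intro sum.cong) (use assms finite_subset in auto)
  also have "\<dots> = (\<Sum>k\<le>card A. int (card A choose k) * ((-1) ^ (card A - k) * G k))"
    by (rule sum_Pow_card[OF assms(1), where h = "\<lambda>k. (-1) ^ (card A - k) * G k"])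
  finally show ?thesis .
qed

text \<open>The subfactorials, by their one-step recurrence, which suits an induction modulo
  \<open>m\<close>; integer-valued because of the alternating sign.\<close>

fun derangement_count :: "nat \<Rightarrow> int" where
  "derangement_count 0 = 1"
| "derangement_count (Suc n) = int (Suc n) * derangement_count n + (-1) ^ Suc n"

lemma derangement_count_closed_form:
  "derangement_count n = (\<Sum>k\<le>n. int (n choose k) * ((-1) ^ (n - k) * fact k))"
proof (induction n)
  case (Suc n)
  have "(Suc n choose Suc k) * fact (Suc k) = Suc n * ((n choose k) * fact k)" for k
    using Suc_times_binomial_eq[of n k] by (simp add: algebra_simps del: binomial_Suc_Suc)
  then have *: "int (Suc n choose Suc k) * fact (Suc k) = int (Suc n) * (int (n choose k) * fact k)"
    for k
    by (metis of_nat_fact of_nat_mult)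
  \<comment> \<open>The term \<open>k = 0\<close> supplies the sign in the recurrence; absorption
    turns the others into \<open>Suc n\<close> times the previous sum.\<close>
  have "(\<Sum>k\<le>Suc n. int (Suc n choose k) * ((-1) ^ (Suc n - k) * fact k)) =
    (-1) ^ Suc n + (\<Sum>k\<le>n. (-1) ^ (n - k) * (int (Suc n choose Suc k) * fact (Suc k)))"
    unfolding sum.atMost_Suc_shift by (simp add: mult_ac)
  also have "\<dots> = (-1) ^ Suc n + int (Suc n) * (\<Sum>k\<le>n. int (n choose k) * ((-1) ^ (n - k) * fact k))"
    unfolding * sum_distrib_left by (simp add: mult_ac)
  finally show ?case using Suc by simp
qed simp

lemma card_derangements:
  assumes "finite A"
  shows "int (card (derangements A)) = derangement_count (card A)"
proof -
  have "(\<Sum>p\<in>derangements A. 1) =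
    (\<Sum>k\<le>card A. int (card A choose k) * ((-1) ^ (card A - k) * fact k))"
    using assms by (rule sum_derangements_by_card) (simp add: card_permutations)
  then show ?thesis by (simp add: derangement_count_closed_form)
qed

text \<open>Modulo \<open>m\<close> the recurrence is unchanged by the shift: its coefficient
  changes by \<open>m\<close>, and its sign is kept because \<open>m\<close> is even.\<close>

lemma derangement_count_add_dvd:
  assumes "even m"
  shows "int m dvd derangement_count (n + m) - derangement_count n"
proof (induction n)
  case 0
  \<comment> \<open>For \<open>m > 0\<close> one unfolding gives a multiple of \<open>m\<close> plus
    \<open>(-1) ^ m = 1\<close>, and this \<open>1\<close> cancels against
    \<open>derangement_count 0\<close>.\<close>
  then show ?case using assms by (cases m) simp_all
next
  case (Suc n)
  have "derangement_count (Suc n + m) - derangement_count (Suc n) =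
    int (Suc n) * (derangement_count (n + m) - derangement_count n) +
    int m * derangement_count (n + m)"
    using assms by (simp add: algebra_simps power_add)
  then show ?case using Suc by (metis dvd_add dvd_mult dvd_triv_left)
qed

text \<open>Composition with a transposition of two points of \<open>T\<close> permutes the summands
  and flips every sign, so the sum is its own negative.\<close>

lemma sum_sign_permutes:
  assumes "finite T"
  shows "(\<Sum>p | p permutes T. sign p) = (if card T \<le> 1 then 1 else 0)"
proof (cases "card T \<le> 1")
  case True
  then have "card T = 0 \<or> card T = 1" by linarith
  then have "{p. p permutes T} = {id}"
    using assms by (auto simp: card_1_singleton_iff)
  then show ?thesis using True by simp
next
  case False
  then obtain a b where ab: "a \<in> T" "b \<in> T" "a \<noteq> b"
    using assms by (metis card_le_Suc0_iff_eq One_nat_def)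
  then have tr: "transpose a b permutes T" by (simp add: permutes_swap_id)
  have "(\<Sum>p | p permutes T. sign p) = (\<Sum>p | p permutes T. sign (p \<circ> transpose a b))"
    by (rule sum_permutations_compose_right[OF tr])
  also have "\<dots> = (\<Sum>p | p permutes T. - sign p)"
    using ab permutes_imp_permutation[OF assms]
    by (intro sum.cong) (simp_all add: sign_compose sign_swap_id permutation_swap_id)
  finally show ?thesis using False by (simp add: sum_negf)
qed

lemma sum_sign_derangements:
  assumes "finite A"
  shows "(\<Sum>p\<in>derangements A. sign p) = (-1) ^ card A * (1 - int (card A))"
proof -
  define n where "n = card A"
  have "(\<Sum>p\<in>derangements A. sign p) =
    (\<Sum>k\<le>n. int (n choose k) * ((-1) ^ (n - k) * (if k \<le> 1 then 1 else 0)))"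
    unfolding n_def using assms sum_sign_permutes by (rule sum_derangements_by_card)
  \<comment> \<open>Only \<open>k = 0\<close> and, for \<open>n > 0\<close>, \<open>k = 1\<close>
    survive.\<close>
  also have "\<dots> = (\<Sum>k\<in>{..n} \<inter> {..1}. int (n choose k) * (-1) ^ (n - k))"
    unfolding sum.inter_restrict[OF finite_atMost] by (intro sum.cong) auto
  also have "\<dots> = (-1) ^ n * (1 - int n)"
    by (cases n) (simp_all add: algebra_simps)
  finally show ?thesis by (simp add: n_def)
qed

lemma even_odd_derangement_number:
  shows "2 * int (even_derangement_number n) = derangement_count n + (-1) ^ n * (1 - int n)"
    and "2 * int (odd_derangement_number n) = derangement_count n - (-1) ^ n * (1 - int n)"
proof -
  let ?D = "derangements {..<n}"
  have fin: "finite ?D" by (simp add: finite_derangements)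
  have split: "(\<Sum>p\<in>?D. f p) = (\<Sum>p | p \<in> ?D \<and> evenperm p. f p) + (\<Sum>p | p \<in> ?D \<and> \<not> evenperm p. f p)"
    for f :: "_ \<Rightarrow> int"
    by (subst sum.union_disjoint[symmetric]) (use fin in \<open>auto intro: sum.cong\<close>)
  have "derangement_count n = int (even_derangement_number n) + int (odd_derangement_number n)"
    using split[of "\<lambda>_. 1"] card_derangements[of "{..<n}"]
    by (simp add: even_derangement_number_def odd_derangement_number_def)
  moreover have "(-1) ^ n * (1 - int n) =
      int (even_derangement_number n) - int (odd_derangement_number n)"
    using split[of sign] sum_sign_derangements[of "{..<n}"]
    by (simp add: even_derangement_number_def odd_derangement_number_def sign_def)
  ultimately show "2 * int (even_derangement_number n) = derangement_count n + (-1) ^ n * (1 - int n)"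
    and "2 * int (odd_derangement_number n) = derangement_count n - (-1) ^ n * (1 - int n)"
    by simp_all
qed

text \<open>Cancelling the factor 2 halves the modulus, which is why the congruences are taken
  modulo \<open>2 * d\<close>.\<close>

lemma mod_eqI_double_dvd:
  assumes "int (2 * d) dvd 2 * int a - 2 * int b"
  shows "a mod d = b mod d"
proof -
  have "2 * int d dvd 2 * (int a - int b)"
    using assms by (simp add: right_diff_distrib)
  then have "int d dvd int a - int b"
    by (subst (asm) dvd_times_left_cancel_iff) simp_all
  then show ?thesis
    by (metis mod_eq_dvd_iff of_nat_eq_iff zmod_int)
qed

theorem proposition22:
  fixes d :: nat
  assumes "d > 1"
  shows "is_period (\<lambda>n. odd_derangement_number n mod d) (2 * d) \<and>
         is_period (\<lambda>n. even_derangement_number n mod d) (2 * d)"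
proof -
  have D: "int (2 * d) dvd derangement_count (n + 2 * d) - derangement_count n" for n
    by (rule derangement_count_add_dvd) simp
  define E :: "nat \<Rightarrow> int" where "E n = (-1) ^ n * (1 - int n)" for n
  \<comment> \<open>The even shift keeps the sign, so only the linear factor changes.\<close>
  have "E (n + 2 * d) - E n = int (2 * d) * - ((-1) ^ n)" for n
    by (simp add: E_def power_add algebra_simps)
  then have E: "int (2 * d) dvd E (n + 2 * d) - E n" for n
    by (metis dvd_triv_left)
  note twice = even_odd_derangement_number[folded E_def]
  have "even_derangement_number (n + 2 * d) mod d = even_derangement_number n mod d" for n
    using dvd_add[OF D E, of n n] by (intro mod_eqI_double_dvd, unfold twice) (simp add: algebra_simps)
  moreover
  have "odd_derangement_number (n + 2 * d) mod d = odd_derangement_number n mod d" for n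
    using dvd_diff[OF D E, of n n] by (intro mod_eqI_double_dvd, unfold twice) (simp add: algebra_simps)
  ultimately show ?thesis
    using assms by (simp add: is_period_def)
qed

end
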